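(* Let $[b_L,b_U]$, $[p_L,p_U]$, $[C_L,C_U]$ be compact intervals of positive real numbers with $p_L>1$. For all $k\in\mathbb{Z}$ let $b_k\in[b_L,b_U]$, $p_k\in[p_L,p_U]$ and $C_k\in[C_L,C_U]$, and put $\mathbf{b}=\{b_k:k\in\mathbb{Z}\}$. Let $\delta>0$, let $\{a_k:k\in\mathbb{Z}\}\subset\mathbb{R}$ be a $\delta$-separated set, and let $I_k=[a_k-(2b_k)^{-1},\,a_k+(2b_k)^{-1}]$. Let $\mathbf{g}=\{g_k\in W(L^\infty,\ell^1):k\in\mathbb{Z}\}$ be a set of windows and set $h_k=g_k\chi_{I_k}$, $\mathbf{h}=\{h_k:k\in\mathbb{Z}\}$, where $\chi_{I_k}$ is the characteristic function of $I_k$. Assume that $\mathcal{G}(\mathbf{h},\mathbf{b})$ is a nonstationary Gabor frame for $L^2(\mathbb{R})$ with lower frame bound $A_h$, and that for $\psi_k=g_k-h_k$, all $k\in\mathbb{Z}$ and almost all $t\in\mathbb{R}$, $$|\psi_k(t)|\le\begin{cases} C_k\big(1+t-a_k-(2b_k)^{-1}\big)^{-p_k}, & t>a_k+(2b_k)^{-1},\\ 0, & t\in I_k,\\ C_k\big(1-t+a_k-(2b_k)^{-1}\big)^{-p_k}, & t<a_k-(2b_k)^{-1}.\end{cases}$$ Define $$E_1=1+\frac{\delta^{-1}+p_L}{(1+\delta)^{p_L}(p_L-1)},\qquad E_2=1+\frac{b_U+p_U}{(1+b_U^{-1})^{p_L}(p_L-1)},\qquad \lambda=4\,b_L^{-2}\,\delta^{-1}\,E_1\,E_2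 .$$ If $C_U<\sqrt{A_h\lambda^{-1}}$, then $\mathcal{G}(\mathbf{g},\mathbf{b})$ is a nonstationary Gabor frame for $L^2(\mathbb{R})$.
   Context: For $b\in\mathbb{R}$ let $M_b g(t)=e^{2\pi i b t}g(t)$. Given windows $\mathbf{g}=\{g_k\in L^2(\mathbb{R}):k\in\mathbb{Z}\}$ and positive frequency-shift parameters $\mathbf{b}=\{b_k:k\in\mathbb{Z}\}$, put $g_{k,l}=M_{b_k l}g_k$; the nonstationary Gabor system is $\mathcal{G}(\mathbf{g},\mathbf{b})=\{g_{k,l}:k,l\in\mathbb{Z}\}$. It is a (nonstationary Gabor) frame for $L^2(\mathbb{R})$ with lower frame bound $A$ and upper frame bound $B$, where $0<A\le B<\infty$, if $A\|f\|_2^2\le\sum_{k,l\in\mathbb{Z}}|\langle f,g_{k,l}\rangle|^2\le B\|f\|_2^2$ for all $f\in L^2(\mathbb{R})$. The Wiener space $W(L^\infty,\ell^1)$ is the set of $g\in L^\infty(\mathbb{R})$ with $\|g\|_{W(L^\infty,\ell^1)}:=\sum_{k\in\mathbb{Z}}\operatorname{ess\,sup}_{t\in[0,1]}|g(t+k)|<\infty$. A set $\{a_k:k\in\mathbb{Z}\}\subset\mathbb{R}$ is $\delta$-separated if $|a_k-a_m|>\delta$ whenever $k\ne m$. *)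

theory Defs
  imports "HOL-Analysis.Analysis" "HOL-Probability.Essential_Supremum"
begin

text \<open>Elements of the function spaces below are represented by Lebesgue measurable functions on
  the real line; equality almost everywhere is not factored out.\<close>

definition L2 :: "(real \<Rightarrow> complex) set" where
  "L2 = {f. f \<in> borel_measurable lebesgue \<and> integrable lebesgue (\<lambda>t. (norm (f t))\<^sup>2)}"

definition L2_norm :: "(real \<Rightarrow> complex) \<Rightarrow> real" where
  "L2_norm f = sqrt (LINT t|lebesgue. (norm (f t))\<^sup>2)"

definition L2_inner :: "(real \<Rightarrow> complex) \<Rightarrow> (real \<Rightarrow> complex) \<Rightarrow> complex" where
  "L2_inner f g = (LINT t|lebesgue. f t * cnj (g t))"

definition Linf :: "(real \<Rightarrow> complex) set" where
  "Linf = {g. g \<in> borel_measurable lebesgue \<and> esssup lebesgue (\<lambda>t. ennreal (norm (g t))) < \<infinity>}"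

text \<open>The sum is taken in the extended nonnegative reals, where it always converges.\<close>

definition wiener_norm :: "(real \<Rightarrow> complex) \<Rightarrow> ennreal" where
  "wiener_norm g =
     (\<Sum>\<^sub>\<infinity>k::int. esssup (lebesgue_on {0..1}) (\<lambda>t. ennreal (norm (g (t + of_int k)))))"

definition wiener_space :: "(real \<Rightarrow> complex) set" where
  "wiener_space = {g \<in> Linf. wiener_norm g < \<infinity>}"

definition modulation :: "real \<Rightarrow> (real \<Rightarrow> complex) \<Rightarrow> real \<Rightarrow> complex" where
  "modulation b g = (\<lambda>t. exp (2 * of_real pi * \<i> * of_real b * of_real t) * g t)"

definition gabor_atom ::
    "(int \<Rightarrow> real \<Rightarrow> complex) \<Rightarrow> (int \<Rightarrow> real) \<Rightarrow> int \<Rightarrow> int \<Rightarrow> real \<Rightarrow> complex" where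
  "gabor_atom g b k l = modulation (b k * of_int l) (g k)"

text \<open>The upper frame inequality includes convergence of the double series: \<open>infsum\<close> would
  silently be \<open>0\<close> for a divergent one.\<close>

definition nsg_frame_bounds ::
    "(int \<Rightarrow> real \<Rightarrow> complex) \<Rightarrow> (int \<Rightarrow> real) \<Rightarrow> real \<Rightarrow> real \<Rightarrow> bool" where
  "nsg_frame_bounds g b A B \<longleftrightarrow>
     (\<forall>k. g k \<in> L2 \<and> 0 < b k) \<and> 0 < A \<and> A \<le> B \<and>
     (\<forall>f\<in>L2.
        (\<lambda>(k, l). (norm (L2_inner f (gabor_atom g b k l)))\<^sup>2) summable_on UNIV \<and>
        A * (L2_norm f)\<^sup>2 \<le> (\<Sum>\<^sub>\<infinity>(k, l). (norm (L2_inner f (gabor_atom g b k l)))\<^sup>2) \<and>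
        (\<Sum>\<^sub>\<infinity>(k, l). (norm (L2_inner f (gabor_atom g b k l)))\<^sup>2) \<le> B * (L2_norm f)\<^sup>2)"

definition nsg_frame :: "(int \<Rightarrow> real \<Rightarrow> complex) \<Rightarrow> (int \<Rightarrow> real) \<Rightarrow> bool" where
  "nsg_frame g b \<longleftrightarrow> (\<exists>A B. nsg_frame_bounds g b A B)"

definition separated :: "real \<Rightarrow> (int \<Rightarrow> real) \<Rightarrow> bool" where
  "separated \<delta> a \<longleftrightarrow> (\<forall>k m. k \<noteq> m \<longrightarrow> \<bar>a k - a m\<bar> > \<delta>)"

end

theory Submission
  imports Defs
begin

text \<open>The frame property survives the perturbation \<open>g k = h k + \<psi> k\<close> as soon as the atoms
  generated by the \<open>\<psi> k\<close> have a Bessel bound below \<open>A\<^sub>h\<close>; this is the triangle inequality in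
  \<open>\<ell>\<^sup>2\<close>. For a single \<open>k\<close> the Bessel bound is \<open>M / b k\<close> times the integral of \<open>\<bar>f\<bar>\<^sup>2\<close> against a
  majorant of \<open>\<bar>\<psi> k\<bar>\<close>, where \<open>M\<close> bounds the sums of the majorant over translates by multiples of
  \<open>1 / b k\<close>; summing over \<open>k\<close> leaves the sum of the majorants at a point. Both sums run over
  separated points one of which has weight zero, and comparing with an integral bounds them by
  \<open>2 C\<^sub>U E\<^sub>2\<close> and \<open>2 C\<^sub>U E\<^sub>1 / (b\<^sub>L \<delta>)\<close>. The second bound uses \<open>\<delta> \<le> 1 / b\<^sub>L\<close>, which holds because
  the lower frame bound of \<open>h\<close> forces the intervals \<open>I k\<close> to cover almost every point.\<close>

section \<open>Weights describing the decay of the tails\<close>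

text \<open>A majorant of \<open>tail_weight\<close> that does not increase with the absolute value
  of \<open>x\<close> when \<open>0 \<le> p\<close>. The tail weight itself jumps up at the edge of
  its core, so it cannot be compared with an integral directly.\<close>

definition plateau :: "real \<Rightarrow> real \<Rightarrow> real \<Rightarrow> real" where
  "plateau R p x = (if \<bar>x\<bar> \<le> R then 1 else (1 + \<bar>x\<bar> - R) powr (- p))"

text \<open>The assumed bound on \<open>\<psi> k\<close> with constant 1, recentred at the origin;
  \<open>R\<close> is the half-width of the interval \<open>I k\<close>.\<close>

definition tail_weight :: "real \<Rightarrow> real \<Rightarrow> real \<Rightarrow> real" where
  "tail_weight R p x = (if \<bar>x\<bar> \<le> R then 0 else (1 + \<bar>x\<bar> - R) powr (- p))"

lemma plateau_nonneg: "0 \<le> plateau R p x"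
  by (simp add: plateau_def)

lemma plateau_le_1: "0 \<le> p \<Longrightarrow> plateau R p x \<le> 1"
  using powr_mono2'[of "- p" 1 "1 + \<bar>x\<bar> - R"] by (simp add: plateau_def)

lemma tail_weight_nonneg: "0 \<le> tail_weight R p x"
  by (simp add: tail_weight_def)

lemma borel_measurable_plateau [measurable]: "plateau R p \<in> borel_measurable borel"
  unfolding plateau_def by measurable

lemma borel_measurable_tail_weight [measurable]: "tail_weight R p \<in> borel_measurable borel"
  unfolding tail_weight_def by measurable

text \<open>A wider core delays the decay. This replaces the half-widths, which vary with
  \<open>k\<close>, by one common radius.\<close>

lemma tail_weight_le_plateau:
  assumes "r \<le> R" "0 \<le> p"
  shows "tail_weight r p x \<le> plateau R p x"
proof (cases "\<bar>x\<bar> \<le> r")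
  case False
  show ?thesis
  proof (cases "\<bar>x\<bar> \<le> R")
    case True
    have "(1 + \<bar>x\<bar> - r) powr (- p) \<le> 1 powr (- p)"
      using False assms by (intro powr_mono2') auto
    with True False show ?thesis by (simp add: plateau_def tail_weight_def)
  next
    case 2: False
    have "(1 + \<bar>x\<bar> - r) powr (- p) \<le> (1 + \<bar>x\<bar> - R) powr (- p)"
      using False 2 assms by (intro powr_mono2') auto
    with 2 False show ?thesis by (simp add: plateau_def tail_weight_def)
  qed
qed (simp add: tail_weight_def plateau_nonneg)

section \<open>Integral comparison for sums over separated points\<close>

lemma nn_integral_half_tail:
  assumes "1 < p"
  shows "(\<integral>\<^sup>+x. ennreal ((1 + x - R) powr (- p)) * indicator {R..} x \<partial>lborel) = ennreal (1 / (p - 1))"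
proof -
  have "(\<integral>\<^sup>+x. ennreal ((1 + x - R) powr (- p)) * indicator {R..} x \<partial>lborel)
     = ennreal (0 - (- ((1 + R - R) powr (1 - p)) / (p - 1)))"
  proof (rule nn_integral_FTC_atLeast[where F = "\<lambda>x. - ((1 + x - R) powr (1 - p)) / (p - 1)"])
    fix x assume "R \<le> x"
    then show "((\<lambda>x. - ((1 + x - R) powr (1 - p)) / (p - 1)) has_real_derivative (1 + x - R) powr (- p)) (at x)"
    proof -
      have "((\<lambda>x. - ((1 + x - R) powr (1 - p)) / (p - 1)) has_real_derivative
          - ((1 - p) * (1 + x - R) powr (1 - p - 1)) / (p - 1)) (at x)"
        using \<open>R \<le> x\<close> assms by (auto intro!: derivative_eq_intros)
      moreover have "- ((1 - p) * (1 + x - R) powr (1 - p - 1)) / (p - 1) = (1 + x - R) powr (- p)"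
        using assms by (auto simp: divide_simps algebra_simps)
      ultimately show ?thesis by metis
    qed
  next
    have "((\<lambda>x. (1 + x - R) powr (1 - p)) \<longlongrightarrow> 0) at_top"
      using assms
      by (intro tendsto_neg_powr filterlim_at_top_mono[OF filterlim_tendsto_add_at_top[OF tendsto_const[of "1 - R"] filterlim_ident]])
         (auto simp: algebra_simps)
    from tendsto_divide[OF tendsto_minus[OF this] tendsto_const[of "p - 1"]] assms
    show "((\<lambda>x. - ((1 + x - R) powr (1 - p)) / (p - 1)) \<longlongrightarrow> 0) at_top" by simp
  qed auto
  then show ?thesis by simp
qed

text \<open>The core contributes \<open>2 * R\<close> and each tail \<open>1 / (p - 1)\<close>, the
  left tail by reflection.\<close>

lemma nn_integral_plateau_le:
  assumes "0 \<le> R" "1 < p"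
  shows "(\<integral>\<^sup>+x. ennreal (plateau R p x) \<partial>lborel) \<le> ennreal (2 * R + 2 / (p - 1))"
proof -
  define f where "f = (\<lambda>x. ennreal ((1 + x - R) powr (- p)) * indicator {R..} x)"
  have f [measurable]: "f \<in> borel_measurable borel" unfolding f_def by measurable
  \<comment> \<open>Pointwise only an inequality: the points where the absolute value of
    \<open>x\<close> is \<open>R\<close> are counted more than once on the right.\<close>
  have "(\<integral>\<^sup>+x. ennreal (plateau R p x) \<partial>lborel) \<le> (\<integral>\<^sup>+x. indicator {-R..R} x + f x + f (0 + (-1) * x) \<partial>lborel)"
    by (intro nn_integral_mono) (auto simp: plateau_def f_def indicator_def abs_if split: if_splits)
  also have "\<dots> = (\<integral>\<^sup>+x. indicator {-R..R} x \<partial>lborel) + (\<integral>\<^sup>+x. f x \<partial>lborel) + (\<integral>\<^sup>+x. f (0 + (-1) * x) \<partial>lborel)"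
    by (simp add: nn_integral_add)
  also have "(\<integral>\<^sup>+x. f (0 + (-1) * x) \<partial>lborel) = (\<integral>\<^sup>+x. f x \<partial>lborel)"
    using nn_integral_real_affine[OF f, of "-1" 0] by simp
  also have "(\<integral>\<^sup>+x. f x \<partial>lborel) = ennreal (1 / (p - 1))"
    unfolding f_def by (rule nn_integral_half_tail[OF assms(2)])
  also have "(\<integral>\<^sup>+x. indicator {-R..R} x \<partial>lborel) = ennreal (2 * R)"
    using assms by simp
  finally show ?thesis using assms by (simp flip: ennreal_plus add: add.assoc)
qed

text \<open>Each point is charged to an interval of length \<open>\<delta>\<close> on its side facing the excluded point
  \<open>x j\<close>; these intervals are disjoint, and the weight at the point is at most the weight on the
  interval.\<close>

lemma separated_sum_plateau_le:
  fixes x :: "'i \<Rightarrow> real"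
  assumes "0 < \<delta>" "1 < p" "finite K" "j \<notin> K"
    and sep: "\<And>k m. k \<noteq> m \<Longrightarrow> \<delta> \<le> \<bar>x k - x m\<bar>"
    and xj: "\<bar>x j\<bar> \<le> R"
  shows "(\<Sum>k\<in>K. plateau R p (x k)) \<le> (2 * R + 2 / (p - 1)) / \<delta>"
proof -
  define J where "J k = (if x j < x k then {x k - \<delta><..<x k} else {x k<..<x k + \<delta>})" for k
  have R: "0 \<le> R" using xj by linarith
  have [measurable]: "J k \<in> sets borel" for k by (simp add: J_def)
  \<comment> \<open>On one side of \<open>x j\<close> this is the separation of the points of
    \<open>K\<close> from each other; across it, the separation from \<open>x j\<close> keeps every
    interval on its own side.\<close>
  have disj: "k = m" if "y \<in> J k" "y \<in> J m" "k \<in> K" "m \<in> K" for y k m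
    using that sep[of k m] sep[of k j] sep[of m j] assms(4)
    by (fastforce simp: J_def abs_if split: if_splits)
  have mono: "plateau R p (x k) \<le> plateau R p y" if "y \<in> J k" "k \<in> K" for y k
  proof (cases "\<bar>y\<bar> \<le> R")
    case True
    then show ?thesis using plateau_le_1[of p R "x k"] assms(2) by (simp add: plateau_def)
  next
    case False
    have "k \<noteq> j" using that assms(4) by auto
    \<comment> \<open>\<open>y\<close> lies between \<open>x j\<close> and \<open>x k\<close>, and
      \<open>x j\<close> is in the core. As \<open>y\<close> is outside the core, moving on from
      \<open>y\<close> to \<open>x k\<close> leads further away from it.\<close>
    then have "R < \<bar>x k\<bar> \<and> \<bar>y\<bar> \<le> \<bar>x k\<bar>"
      using that False xj sep[of k j] assms(1) by (auto simp: J_def abs_if split: if_splits)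
    then show ?thesis using False assms(2)
      by (auto simp: plateau_def intro!: powr_mono2')
  qed
  have ptw: "(\<Sum>k\<in>K. ennreal (plateau R p (x k)) * indicator (J k) y) \<le> ennreal (plateau R p y)" for y
  proof (cases "\<exists>k\<in>K. y \<in> J k")
    case True
    then obtain k where k: "k \<in> K" "y \<in> J k" by auto
    then have "(\<Sum>m\<in>K. ennreal (plateau R p (x m)) * indicator (J m) y)
        = (\<Sum>m\<in>{k}. ennreal (plateau R p (x m)) * indicator (J m) y)"
      using disj assms(3) by (intro sum.mono_neutral_right) (auto simp: indicator_def)
    then show ?thesis using k mono by (simp add: ennreal_leI)
  next
    case False
    then have "(\<Sum>k\<in>K. ennreal (plateau R p (x k)) * indicator (J k) y) = 0"
      by (intro sum.neutral) auto
    then show ?thesis by (simp only: zero_le)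
  qed
  have "ennreal (\<delta> * (\<Sum>k\<in>K. plateau R p (x k))) = (\<Sum>k\<in>K. ennreal (plateau R p (x k)) * ennreal \<delta>)"
    using assms by (simp add: sum_distrib_left plateau_nonneg ennreal_mult sum_ennreal[symmetric] mult.commute)
  also have "\<dots> = (\<Sum>k\<in>K. ennreal (plateau R p (x k)) * emeasure lborel (J k))"
    using assms(1) by (intro sum.cong) (auto simp: J_def)
  also have "\<dots> = (\<integral>\<^sup>+y. (\<Sum>k\<in>K. ennreal (plateau R p (x k)) * indicator (J k) y) \<partial>lborel)"
    by (subst nn_integral_sum) (auto simp: nn_integral_cmult_indicator)
  also have "\<dots> \<le> (\<integral>\<^sup>+y. ennreal (plateau R p y) \<partial>lborel)"
    by (intro nn_integral_mono ptw)
  also have "\<dots> \<le> ennreal (2 * R + 2 / (p - 1))"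
    by (rule nn_integral_plateau_le[OF R assms(2)])
  finally have "\<delta> * (\<Sum>k\<in>K. plateau R p (x k)) \<le> 2 * R + 2 / (p - 1)"
    using R assms(2) by (subst (asm) ennreal_le_iff) auto
  then show ?thesis using assms(1) by (simp add: field_simps)
qed

text \<open>The point \<open>x j\<close> lies in its own core and has weight zero. Dropping it makes
  it the excluded point of the plateau estimate, which saves a whole extra term.\<close>

lemma separated_sum_tail_weight_le:
  fixes x r :: "'i \<Rightarrow> real"
  assumes "0 < \<delta>" "1 < p" "finite K"
    and sep: "\<And>k m. k \<noteq> m \<Longrightarrow> \<delta> \<le> \<bar>x k - x m\<bar>"
    and r: "\<And>k. r k \<le> R" and xj: "\<bar>x j\<bar> \<le> r j"
  shows "(\<Sum>k\<in>K. tail_weight (r k) p (x k)) \<le> (2 * R + 2 / (p - 1)) / \<delta>"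
proof -
  have "(\<Sum>k\<in>K. tail_weight (r k) p (x k)) = (\<Sum>k\<in>K - {j}. tail_weight (r k) p (x k))"
    using xj assms(3) by (intro sum.mono_neutral_right) (auto simp: tail_weight_def)
  also have "\<dots> \<le> (\<Sum>k\<in>K - {j}. plateau R p (x k))"
    using r assms(2) by (intro sum_mono tail_weight_le_plateau) auto
  also have "\<dots> \<le> (2 * R + 2 / (p - 1)) / \<delta>"
    using assms order_trans[OF xj r] by (intro separated_sum_plateau_le[where j = j]) auto
  finally show ?thesis .
qed

section \<open>The elementary inequality behind \<open>E\<^sub>1\<close> and
  \<open>E\<^sub>2\<close>\<close>

text \<open>From \<open>x / (1 + x) \<le> ln (1 + x)\<close> the power \<open>(1 + x) powr p\<close>
  is at least \<open>exp v\<close> with \<open>v = p * x / (1 + x)\<close>, and the quadratic Taylor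
  bound of \<open>exp v\<close> exceeds \<open>2 * v\<close>. The result gives the sign of a
  derivative in the next lemma.\<close>

lemma double_le_one_plus_powr:
  fixes x p :: real
  assumes "0 \<le> x" "0 \<le> p"
  shows "2 * x * p \<le> (1 + x) powr (p + 1)"
proof -
  define v where "v = p * x / (1 + x)"
  have v: "0 \<le> v" "(1 + x) * v = p * x" using assms by (simp_all add: v_def)
  have "ln (1 / (1 + x)) \<le> 1 / (1 + x) - 1" using assms by (intro ln_le_minus_one) auto
  then have "x / (1 + x) \<le> ln (1 + x)" using assms by (simp add: ln_div diff_divide_eq_iff divide_simps)
  then have "v \<le> p * ln (1 + x)"
    using assms mult_left_mono[of "x / (1 + x)" "ln (1 + x)" p] by (simp add: v_def)
  have "2 * v \<le> 1 + v + v\<^sup>2 / 2"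
    using zero_le_power2[of "v - 1"] by (simp add: power2_diff)
  also have "\<dots> \<le> exp v" using v(1) by (rule exp_lower_Taylor_quadratic)
  also have "\<dots> \<le> (1 + x) powr p" using \<open>v \<le> _\<close> assms by (simp add: powr_def)
  finally have "(1 + x) * (2 * v) \<le> (1 + x) * (1 + x) powr p" using assms by (intro mult_left_mono) auto
  then have "2 * ((1 + x) * v) \<le> (1 + x) powr (p + 1)" using assms by (simp add: powr_add mult_ac)
  then show ?thesis unfolding v(2) by (simp add: mult_ac)
qed

text \<open>The right-hand side bounds \<open>\<Sum>j. (1 + j d) powr (- p)\<close> by an integral comparison from
  \<open>j = 1\<close> on; the left-hand side is the trapezoidal lower bound of that sum.\<close>

lemma trapezoid_le_integral_test:
  fixes d p :: real
  assumes "0 < d" "1 < p"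
  shows "1 / (d * (p - 1)) + 1 / 2 \<le> 1 + (1 / d + p) / ((1 + d) powr p * (p - 1))"
proof -
  \<comment> \<open>After moving \<open>1 / 2\<close> to the right and multiplying by
    \<open>d * (p - 1)\<close>, the claim reads \<open>G 0 \<le> G d\<close> with
    \<open>G 0 = 1\<close>. The factor \<open>1 + p * x\<close> of \<open>(1 + x) powr (- p)\<close>
    is split as \<open>(1 + x) + (p - 1) * x\<close>, so that two terms cancel in the
    derivative.\<close>
  define G where "G x = (p - 1) * x / 2 + (p - 1) * x * (1 + x) powr (- p) + (1 + x) powr (1 - p)" for x
  have "G 0 \<le> G d"
  proof (rule DERIV_nonneg_imp_nondecreasing[where f = G])
    fix x assume x: "0 \<le> x" "x \<le> d"
    have "(G has_real_derivative
        (p - 1) / 2 + ((p - 1) * (1 + x) powr (- p) + (p - 1) * x * (- p * (1 + x) powr (- (p + 1))))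
        + (1 - p) * (1 + x) powr (- p)) (at x)"
      unfolding G_def using x by (auto intro!: derivative_eq_intros)
    moreover have "(p - 1) / 2 + ((p - 1) * u + (p - 1) * x * (- p * w)) + (1 - p) * u
        = (p - 1) * (1 / 2 - x * p * w)" for u w
      by (simp add: algebra_simps)
    moreover have "x * p * (1 + x) powr (- (p + 1)) \<le> 1 / 2"
      unfolding powr_minus using double_le_one_plus_powr[of x p] x assms by (simp add: field_simps)
    ultimately show "\<exists>y. (G has_real_derivative y) (at x) \<and> 0 \<le> y"
      using assms by (intro exI conjI) (assumption, simp)
  qed (use assms in auto)
  then have *: "1 \<le> (p - 1) * d / 2 + (p - 1) * d * (1 + d) powr (- p) + (1 + d) * (1 + d) powr (- p)"
    using assms powr_add[of "1 + d" 1 "- p"] by (simp add: G_def)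
  have "1 / (d * (p - 1)) \<le> ((p - 1) * d / 2 + (p - 1) * d * (1 + d) powr (- p) + (1 + d) * (1 + d) powr (- p)) / (d * (p - 1))"
    using * assms by (intro divide_right_mono) auto
  also have "\<dots> = 1 / 2 + (1 / d + p) / ((1 + d) powr p * (p - 1))"
    using assms by (simp add: powr_minus field_simps)
  finally show ?thesis by simp
qed

section \<open>Modulations and square-integrable functions\<close>

lemma modulation_eq_cis: "modulation \<beta> g t = cis (2 * pi * \<beta> * t) * g t"
  by (simp add: modulation_def cis_conv_exp mult_ac)

lemma borel_measurable_lebesgueI:
  fixes f :: "real \<Rightarrow> 'b::topological_space"
  shows "f \<in> borel_measurable borel \<Longrightarrow> f \<in> borel_measurable lebesgue"
  by (rule measurable_completion) simp

lemma borel_measurable_cnj [measurable (raw)]: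
  "f \<in> borel_measurable M \<Longrightarrow> (\<lambda>x. cnj (f x)) \<in> borel_measurable M"
  by (erule measurable_compose) (intro borel_measurable_continuous_onI continuous_on_cnj continuous_on_id)

lemma borel_measurable_cis_affine: "(\<lambda>t. cis (c * t)) \<in> borel_measurable borel"
  by (intro borel_measurable_continuous_onI continuous_intros)

lemma L2_modulation:
  assumes "g \<in> L2"
  shows "modulation \<beta> g \<in> L2"
proof -
  have [measurable]: "g \<in> borel_measurable lebesgue" using assms by (simp add: L2_def)
  have [measurable]: "(\<lambda>t. cis (2 * pi * \<beta> * t)) \<in> borel_measurable lebesgue"
    by (intro borel_measurable_lebesgueI borel_measurable_cis_affine)
  show ?thesis using assms unfolding L2_def modulation_eq_cis[abs_def] by (simp add: norm_mult)
qed

lemma L2_integrable_mult_cnj: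
  assumes "f \<in> L2" "g \<in> L2"
  shows "integrable lebesgue (\<lambda>t. f t * cnj (g t))"
proof (rule Bochner_Integration.integrable_bound)
  show "integrable lebesgue (\<lambda>t. (norm (f t))\<^sup>2 + (norm (g t))\<^sup>2)"
    using assms by (simp add: L2_def)
  show "(\<lambda>t. f t * cnj (g t)) \<in> borel_measurable lebesgue"
    using assms by (intro borel_measurable_times borel_measurable_cnj) (auto simp: L2_def)
  have "norm (f t * cnj (g t)) \<le> (norm (f t))\<^sup>2 + (norm (g t))\<^sup>2" for t
    using sum_squares_bound[of "norm (f t)" "norm (g t)"]
      mult_nonneg_nonneg[OF norm_ge_zero[of "f t"] norm_ge_zero[of "g t"]]
    unfolding norm_mult complex_mod_cnj by linarith
  then show "AE t in lebesgue. norm (f t * cnj (g t)) \<le> norm ((norm (f t))\<^sup>2 + (norm (g t))\<^sup>2)"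
    by simp
qed

lemma L2_add:
  assumes "f \<in> L2" "g \<in> L2"
  shows "(\<lambda>t. f t + g t) \<in> L2"
proof -
  have [measurable]: "f \<in> borel_measurable lebesgue" "g \<in> borel_measurable lebesgue"
    using assms by (auto simp: L2_def)
  have "integrable lebesgue (\<lambda>t. (norm (f t + g t))\<^sup>2)"
  proof (rule Bochner_Integration.integrable_bound)
    show "integrable lebesgue (\<lambda>t. 2 * (norm (f t))\<^sup>2 + 2 * (norm (g t))\<^sup>2)"
      using assms by (simp add: L2_def)
    have "(norm (f t + g t))\<^sup>2 \<le> 2 * (norm (f t))\<^sup>2 + 2 * (norm (g t))\<^sup>2" for t
      using power_mono[OF norm_triangle_ineq[of "f t" "g t"], of 2]
        sum_squares_bound[of "norm (f t)" "norm (g t)"]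
      by (simp add: power2_sum)
    then show "AE t in lebesgue. norm ((norm (f t + g t))\<^sup>2) \<le> norm (2 * (norm (f t))\<^sup>2 + 2 * (norm (g t))\<^sup>2)"
      by simp
  qed measurable
  then show ?thesis by (simp add: L2_def)
qed

lemma L2_norm_sq: "(L2_norm f)\<^sup>2 = (LINT t|lebesgue. (norm (f t))\<^sup>2)"
  by (simp add: L2_norm_def)

section \<open>Periodization, orthogonality and the Bessel bound of a single window\<close>

text \<open>Cutting the line into cells of length \<open>c\<close> and shifting each onto the first
  leaves \<open>P\<close> unchanged and turns \<open>W\<close> into the sum of its translates, which
  is at most \<open>M\<close>.\<close>

lemma nn_integral_periodization_le:
  fixes W :: "real \<Rightarrow> real" and P :: "real \<Rightarrow> ennreal"
  assumes "0 < c" and [measurable]: "W \<in> borel_measurable borel" "P \<in> borel_measurable borel"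
    and W0: "\<And>t. 0 \<le> W t" and per: "\<And>t j. P (t + of_int j * c) = P t"
    and M: "\<And>t J. finite J \<Longrightarrow> (\<Sum>j\<in>J. W (t + of_int j * c)) \<le> M"
  shows "(\<integral>\<^sup>+t. W t * P t \<partial>lborel) \<le> ennreal M * (\<integral>\<^sup>+t. P t * indicator {0..c} t \<partial>lborel)"
proof -
  \<comment> \<open>Half-open cells partition the line exactly. \<open>int_decode\<close> enumerates
    the integers by natural numbers, so that series and integral can be exchanged.\<close>
  define A where "A n = {of_int (int_decode n) * c..<of_int (int_decode n) * c + c}" for n
  have [measurable]: "A n \<in> sets borel" for n by (simp add: A_def)
  have inA: "x \<in> A n \<longleftrightarrow> int_decode n = \<lfloor>x / c\<rfloor>" for x n
    using assms(1) by (simp add: A_def eq_commute[of "int_decode n"] floor_eq_iff field_simps)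
  have disj: "disjoint_family A" by (auto simp: disjoint_family_on_def inA dest: injD[OF inj_int_decode[of UNIV], OF trans[OF _ sym]])
  have "(\<integral>\<^sup>+t. W t * P t \<partial>lborel) = (\<integral>\<^sup>+t. (\<Sum>n. (W t * P t) * indicator (A n) t) \<partial>lborel)"
  proof (intro nn_integral_cong)
    fix t
    have "t \<in> A (int_encode \<lfloor>t / c\<rfloor>)" by (simp add: inA)
    from suminf_cmult_indicator[OF disj this, of "\<lambda>_. W t * P t"]
    show "W t * P t = (\<Sum>n. (W t * P t) * indicator (A n) t)" by simp
  qed
  also have "\<dots> = (\<Sum>n. \<integral>\<^sup>+t. (W t * P t) * indicator (A n) t \<partial>lborel)"
    by (intro nn_integral_suminf) measurable
  also have "\<dots> = (\<Sum>n. \<integral>\<^sup>+t. W (t + of_int (int_decode n) * c) * (P t * indicator {0..<c} t) \<partial>lborel)"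
  proof (intro suminf_cong)
    fix n
    let ?s = "of_int (int_decode n) * c"
    have "(\<integral>\<^sup>+t. (W t * P t) * indicator (A n) t \<partial>lborel)
        = (\<integral>\<^sup>+t. (W (?s + 1 * t) * P (?s + 1 * t)) * indicator (A n) (?s + 1 * t) \<partial>lborel)"
      using nn_integral_real_affine[of "\<lambda>t. (W t * P t) * indicator (A n) t" 1 ?s] by simp
    also have "\<dots> = (\<integral>\<^sup>+t. W (t + ?s) * (P t * indicator {0..<c} t) \<partial>lborel)"
      using per[of _ "int_decode n"]
      by (intro nn_integral_cong) (auto simp: A_def indicator_def add.commute)
    finally show "(\<integral>\<^sup>+t. (W t * P t) * indicator (A n) t \<partial>lborel)
        = (\<integral>\<^sup>+t. W (t + ?s) * (P t * indicator {0..<c} t) \<partial>lborel)" .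
  qed
  also have "\<dots> = (\<integral>\<^sup>+t. (\<Sum>n. W (t + of_int (int_decode n) * c) * (P t * indicator {0..<c} t)) \<partial>lborel)"
    by (intro nn_integral_suminf[symmetric]) measurable
  also have "\<dots> \<le> (\<integral>\<^sup>+t. ennreal M * (P t * indicator {0..c} t) \<partial>lborel)"
  proof (intro nn_integral_mono)
    fix t
    have "(\<Sum>n. ennreal (W (t + of_int (int_decode n) * c))) \<le> ennreal M"
    proof (intro suminf_le_const summableI)
      fix N
      have "(\<Sum>n<N. W (t + of_int (int_decode n) * c)) = (\<Sum>j\<in>int_decode ` {..<N}. W (t + of_int j * c))"
        by (subst sum.reindex) (auto intro: inj_on_subset[OF inj_int_decode])
      also have "\<dots> \<le> M" by (rule M) simp
      finally show "(\<Sum>n<N. ennreal (W (t + of_int (int_decode n) * c))) \<le> ennreal M"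
        using W0 by (simp add: sum_ennreal ennreal_leI)
    qed
    then show "(\<Sum>n. W (t + of_int (int_decode n) * c) * (P t * indicator {0..<c} t))
        \<le> ennreal M * (P t * indicator {0..c} t)"
      by (subst ennreal_suminf_multc) (auto intro!: mult_mono simp: indicator_def)
  qed
  also have "\<dots> = ennreal M * (\<integral>\<^sup>+t. P t * indicator {0..c} t \<partial>lborel)"
    by (intro nn_integral_cmult) measurable
  finally show ?thesis .
qed

text \<open>Orthogonality of characters: for nonzero \<open>n\<close> the primitive takes equal
  values at both ends of the period.\<close>

lemma has_integral_cis_period:
  fixes b :: real and n :: int
  assumes "0 < b"
  shows "((\<lambda>t. cis (2 * pi * (b * of_int n) * t)) has_integral (if n = 0 then of_real (1 / b) else 0)) {0..1 / b}"
proof (cases "n = 0")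
  case True
  then show ?thesis using has_integral_const_real[of "1::complex" 0 "1 / b"] assms
    by (simp add: scaleR_conv_of_real)
next
  case False
  define \<theta> where "\<theta> = 2 * pi * (b * of_int n)"
  have \<theta>: "\<theta> \<noteq> 0" using False assms by (simp add: \<theta>_def)
  have "((\<lambda>t. cis (\<theta> * t)) has_integral (cis (\<theta> * (1 / b)) / (\<i> * \<theta>) - cis (\<theta> * 0) / (\<i> * \<theta>))) {0..1 / b}"
  proof (rule fundamental_theorem_of_calculus)
    fix t assume "t \<in> {0..1 / b}"
    have "((\<lambda>z. exp (\<i> * of_real \<theta> * z) / (\<i> * of_real \<theta>)) has_field_derivative exp (\<i> * of_real \<theta> * of_real t)) (at (of_real t))"
      using \<theta> by (auto intro!: derivative_eq_intros)
    from has_vector_derivative_real_field[OF this, of "{0..1 / b}"]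
    show "((\<lambda>t. cis (\<theta> * t) / (\<i> * \<theta>)) has_vector_derivative cis (\<theta> * t)) (at t within {0..1 / b})"
      by (simp add: cis_conv_exp mult.assoc)
  qed (use assms in simp)
  moreover have "cis (\<theta> * (1 / b)) = 1"
    using assms cis_multiple_2pi[of "of_int n"] by (simp add: \<theta>_def mult_ac)
  ultimately show ?thesis using False by (simp add: \<theta>_def)
qed

text \<open>Parseval's identity over one period: the square expands into a double sum of characters,
  of which only the diagonal survives integration. The nonnegative integral is the form that the
  periodization bound produces.\<close>

lemma nn_integral_trig_poly:
  fixes c :: "int \<Rightarrow> complex"
  assumes "0 < b" "finite L"
  shows "(\<integral>\<^sup>+t. ennreal ((norm (\<Sum>l\<in>L. c l * cis (2 * pi * (b * of_int l) * t)))\<^sup>2) * indicator {0..1 / b} t \<partial>lborel)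
    = ennreal ((\<Sum>l\<in>L. (norm (c l))\<^sup>2) / b)"
proof (rule nn_integral_has_integral_lebesgue')
  define e where "e l t = cis (2 * pi * (b * of_int l) * t)" for l :: int and t
  have ee: "e l t * cnj (e m t) = e (l - m) t" for l m t
    by (simp add: e_def cis_cnj cis_mult algebra_simps)
  have "((\<lambda>t. \<Sum>l\<in>L. \<Sum>m\<in>L. (c l * cnj (c m)) * e (l - m) t) has_integral
      (\<Sum>l\<in>L. \<Sum>m\<in>L. (c l * cnj (c m)) * (if l - m = 0 then of_real (1 / b) else 0))) {0..1 / b}"
    unfolding e_def
    by (intro has_integral_sum has_integral_mult_right has_integral_cis_period assms)
  also have "(\<lambda>t. \<Sum>l\<in>L. \<Sum>m\<in>L. (c l * cnj (c m)) * e (l - m) t)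
      = (\<lambda>t. of_real ((norm (\<Sum>l\<in>L. c l * e l t))\<^sup>2))"
    unfolding ee[symmetric] complex_norm_square by (simp add: sum_product mult_ac)
  also have "(\<Sum>l\<in>L. \<Sum>m\<in>L. (c l * cnj (c m)) * (if l - m = 0 then of_real (1 / b) else 0))
      = (of_real ((\<Sum>l\<in>L. (norm (c l))\<^sup>2) / b) :: complex)"
    using assms(2) by (simp add: if_distrib sum.delta complex_norm_square[symmetric] sum_divide_distrib cong: if_cong)
  finally have "((\<lambda>t. complex_of_real ((norm (\<Sum>l\<in>L. c l * e l t))\<^sup>2)) has_integral of_real ((\<Sum>l\<in>L. (norm (c l))\<^sup>2) / b)) {0..1 / b}" .
  from has_integral_linear[OF this bounded_linear_Re]
  show "((\<lambda>t. (norm (\<Sum>l\<in>L. c l * cis (2 * pi * (b * of_int l) * t)))\<^sup>2) has_integral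
      (\<Sum>l\<in>L. (norm (c l))\<^sup>2) / b) {0..1 / b}"
    by (simp only: o_def Re_complex_of_real e_def)
qed simp

text \<open>By duality \<open>S = \<Sum>\<bar>c l\<bar>\<^sup>2\<close> is the integral of \<open>f\<close> against \<open>\<psi>\<close> times a trigonometric
  polynomial \<open>T\<close> with coefficients \<open>c l\<close>. Splitting \<open>\<bar>f\<bar> W \<bar>T\<bar>\<close> by AM-GM with parameter
  \<open>M / b\<close> makes the \<open>T\<close>-part at most \<open>S / 2\<close>, by periodization and orthogonality.\<close>

lemma
  fixes W :: "real \<Rightarrow> real" and \<psi> :: "real \<Rightarrow> complex"
  assumes "0 < b" "0 < M"
    and psi [measurable]: "\<psi> \<in> borel_measurable lebesgue"
    and W [measurable]: "W \<in> borel_measurable borel"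
    and W0: "\<And>t. 0 \<le> W t"
    and sum_W: "\<And>t J. finite J \<Longrightarrow> (\<Sum>j\<in>J. W (t + of_int j * (1 / b))) \<le> M"
    and bound: "AE t in lebesgue. norm (\<psi> t) \<le> W t"
  shows L2_of_summable_translates: "\<psi> \<in> L2"
    and integrable_weighted_L2: "f \<in> L2 \<Longrightarrow> integrable lebesgue (\<lambda>t. (norm (f t))\<^sup>2 * W t)"
    and weighted_bessel: "f \<in> L2 \<Longrightarrow> finite L \<Longrightarrow>
      (\<Sum>l\<in>L. (norm (L2_inner f (modulation (b * of_int l) \<psi>)))\<^sup>2)
        \<le> M / b * (LINT t|lebesgue. (norm (f t))\<^sup>2 * W t)"
proof -
  have WM: "W t \<le> M" for t using sum_W[of "{0}" t] by simp
  have [measurable]: "W \<in> borel_measurable lebesgue" by (rule borel_measurable_lebesgueI[OF W])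
  have period: "(\<integral>\<^sup>+t. W t * P t \<partial>lebesgue) \<le> ennreal M * (\<integral>\<^sup>+t. P t * indicator {0..1 / b} t \<partial>lborel)"
    if "P \<in> borel_measurable borel" "\<And>t j. P (t + of_int j * (1 / b)) = P t" for P :: "real \<Rightarrow> ennreal"
    unfolding nn_integral_completion using assms that
    by (intro nn_integral_periodization_le) auto
  show psi_L2: "\<psi> \<in> L2"
  proof -
    \<comment> \<open>The square of \<open>\<psi>\<close> is at most \<open>M * W\<close>. The
      factor \<open>1\<close> is the constant periodic function for which \<open>period\<close>
      bounds the integral of \<open>W\<close>.\<close>
    have "(\<integral>\<^sup>+t. ennreal (norm ((norm (\<psi> t))\<^sup>2)) \<partial>lebesgue) \<le> (\<integral>\<^sup>+t. ennreal M * (ennreal (W t) * 1) \<partial>lebesgue)"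
    proof (rule nn_integral_mono_AE, use bound in eventually_elim)
      fix t assume t: "norm (\<psi> t) \<le> W t"
      have "(norm (\<psi> t))\<^sup>2 \<le> M * W t"
        using mult_mono[OF order_trans[OF t WM] t] assms(2) by (simp add: power2_eq_square)
      then show "ennreal (norm ((norm (\<psi> t))\<^sup>2)) \<le> ennreal M * (ennreal (W t) * 1)"
        using W0 assms(2) by (simp add: ennreal_leI flip: ennreal_mult)
    qed
    also have "\<dots> = ennreal M * (\<integral>\<^sup>+t. ennreal (W t) * 1 \<partial>lebesgue)"
      by (intro nn_integral_cmult) measurable
    also have "\<dots> \<le> ennreal M * (ennreal M * (\<integral>\<^sup>+t. 1 * indicator {0..1 / b} t \<partial>lborel))"
      by (intro mult_left_mono period) auto
    also have "\<dots> < \<infinity>"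
      using assms(1) by (simp add: ennreal_mult_less_top)
    finally have "integrable lebesgue (\<lambda>t. (norm (\<psi> t))\<^sup>2)"
      by (intro integrableI_bounded) auto
    then show ?thesis by (simp add: L2_def)
  qed
  show int_fW: "integrable lebesgue (\<lambda>t. (norm (f t))\<^sup>2 * W t)" if f: "f \<in> L2" for f
  proof (rule Bochner_Integration.integrable_bound)
    have [measurable]: "f \<in> borel_measurable lebesgue" using f by (simp add: L2_def)
    show "integrable lebesgue (\<lambda>t. (norm (f t))\<^sup>2 * M)" using f by (simp add: L2_def)
    show "(\<lambda>t. (norm (f t))\<^sup>2 * W t) \<in> borel_measurable lebesgue" by measurable
    show "AE t in lebesgue. norm ((norm (f t))\<^sup>2 * W t) \<le> norm ((norm (f t))\<^sup>2 * M)"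
      using WM W0 assms(2) by (auto simp: abs_mult intro!: mult_left_mono)
  qed
  show "(\<Sum>l\<in>L. (norm (L2_inner f (modulation (b * of_int l) \<psi>)))\<^sup>2)
        \<le> M / b * (LINT t|lebesgue. (norm (f t))\<^sup>2 * W t)" if f: "f \<in> L2" and L: "finite L" for f L
  proof -
    define c where "c l = L2_inner f (modulation (b * of_int l) \<psi>)" for l
    define T where "T t = (\<Sum>l\<in>L. c l * cis (2 * pi * (b * of_int l) * t))" for t
    define S where "S = (\<Sum>l\<in>L. (norm (c l))\<^sup>2)"
    have S0: "0 \<le> S" by (simp add: S_def sum_nonneg)
    have T_borel [measurable]: "T \<in> borel_measurable borel"
      unfolding T_def by (intro borel_measurable_continuous_onI continuous_intros)
    have T_leb [measurable]: "T \<in> borel_measurable lebesgue" by (rule borel_measurable_lebesgueI[OF T_borel])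
    have "T (t + of_int j * (1 / b)) = T t" for t and j :: int
    proof -
      have "cis (2 * pi * (b * of_int l) * (t + of_int j * (1 / b))) = cis (2 * pi * (b * of_int l) * t)" for l :: int
      proof -
        have "2 * pi * (b * of_int l) * (t + of_int j * (1 / b)) = 2 * pi * (b * of_int l) * t + 2 * pi * of_int (l * j)"
          using assms(1) by (simp add: field_simps)
        then show ?thesis by (simp only: flip: cis_mult) (simp add: cis_multiple_2pi del: of_int_mult)
      qed
      then show ?thesis by (simp add: T_def)
    qed
    then have "(\<integral>\<^sup>+t. W t * ennreal ((norm (T t))\<^sup>2) \<partial>lebesgue)
        \<le> ennreal M * (\<integral>\<^sup>+t. ennreal ((norm (T t))\<^sup>2) * indicator {0..1 / b} t \<partial>lborel)"
      by (intro period) auto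
    also have "\<dots> = ennreal (M * (S / b))"
      unfolding T_def S_def nn_integral_trig_poly[OF assms(1) L]
      using assms(1,2) by (subst ennreal_mult) (auto simp: sum_nonneg)
    finally have WT: "(\<integral>\<^sup>+t. ennreal (W t * (norm (T t))\<^sup>2) \<partial>lebesgue) \<le> ennreal (M * (S / b))"
      using W0 by (simp add: ennreal_mult)
    have int_WT: "integrable lebesgue (\<lambda>t. W t * (norm (T t))\<^sup>2)"
      using W0 le_less_trans[OF WT ennreal_less_top] by (intro integrableI_nonneg) auto
    have le_WT: "(LINT t|lebesgue. W t * (norm (T t))\<^sup>2) \<le> M * (S / b)"
      using WT S0 W0 assms by (subst (asm) nn_integral_eq_integral[OF int_WT]) auto
    have int_c: "integrable lebesgue (\<lambda>t. f t * cnj (modulation (b * of_int l) \<psi> t))" for l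
      by (intro L2_integrable_mult_cnj f L2_modulation psi_L2)
    have "complex_of_real S = (\<Sum>l\<in>L. cnj (c l) * (LINT t|lebesgue. f t * cnj (modulation (b * of_int l) \<psi> t)))"
      unfolding S_def of_real_sum complex_norm_square by (simp add: c_def L2_inner_def mult.commute)
    also have "\<dots> = (LINT t|lebesgue. (\<Sum>l\<in>L. cnj (c l) * (f t * cnj (modulation (b * of_int l) \<psi> t))))"
      by (subst Bochner_Integration.integral_sum) (auto intro: integrable_mult_right int_c)
    also have eq: "(\<lambda>t. \<Sum>l\<in>L. cnj (c l) * (f t * cnj (modulation (b * of_int l) \<psi> t)))
        = (\<lambda>t. f t * cnj (\<psi> t) * cnj (T t))"
      by (simp add: modulation_eq_cis T_def sum_distrib_left mult_ac)
    finally have "S = norm (LINT t|lebesgue. f t * cnj (\<psi> t) * cnj (T t))"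
      using S0 by (metis abs_of_nonneg norm_of_real)
    also have "\<dots> \<le> (LINT t|lebesgue. norm (f t * cnj (\<psi> t) * cnj (T t)))"
      by (rule integral_norm_bound)
    also have "\<dots> \<le> (LINT t|lebesgue. M / (2 * b) * ((norm (f t))\<^sup>2 * W t) + b / (2 * M) * (W t * (norm (T t))\<^sup>2))"
    proof (rule integral_mono_AE)
      have "integrable lebesgue (\<lambda>t. \<Sum>l\<in>L. cnj (c l) * (f t * cnj (modulation (b * of_int l) \<psi> t)))"
        by (intro Bochner_Integration.integrable_sum integrable_mult_right int_c)
      then show "integrable lebesgue (\<lambda>t. norm (f t * cnj (\<psi> t) * cnj (T t)))"
        unfolding eq by (rule integrable_norm)
      show "integrable lebesgue (\<lambda>t. M / (2 * b) * ((norm (f t))\<^sup>2 * W t) + b / (2 * M) * (W t * (norm (T t))\<^sup>2))"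
        by (intro Bochner_Integration.integrable_add integrable_mult_right int_fW f int_WT)
      show "AE t in lebesgue. norm (f t * cnj (\<psi> t) * cnj (T t))
          \<le> M / (2 * b) * ((norm (f t))\<^sup>2 * W t) + b / (2 * M) * (W t * (norm (T t))\<^sup>2)"
        using bound
      proof eventually_elim
        case (elim t)
        let ?x = "norm (f t)" and ?y = "norm (T t)"
        have "norm (f t * cnj (\<psi> t) * cnj (T t)) = norm (\<psi> t) * (?x * ?y)"
          by (simp add: norm_mult)
        also have "\<dots> \<le> W t * (?x * ?y)" using elim by (intro mult_right_mono) auto
        also have "\<dots> \<le> W t * (M / (2 * b) * ?x\<^sup>2 + b / (2 * M) * ?y\<^sup>2)"
        proof (intro mult_left_mono W0)
          have "0 \<le> (M * ?x - b * ?y)\<^sup>2 / (2 * M * b)" using assms(1,2) by simp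
          also have "\<dots> = M / (2 * b) * ?x\<^sup>2 + b / (2 * M) * ?y\<^sup>2 - ?x * ?y"
            using assms(1,2) by (simp add: field_simps power2_eq_square)
          finally show "?x * ?y \<le> M / (2 * b) * ?x\<^sup>2 + b / (2 * M) * ?y\<^sup>2" by simp
        qed
        finally show ?case by (simp add: algebra_simps)
      qed
    qed
    also have "\<dots> = M / (2 * b) * (LINT t|lebesgue. (norm (f t))\<^sup>2 * W t) + b / (2 * M) * (LINT t|lebesgue. W t * (norm (T t))\<^sup>2)"
      by (subst Bochner_Integration.integral_add) (auto intro!: integrable_mult_right int_fW f int_WT)
    also have "\<dots> \<le> M / (2 * b) * (LINT t|lebesgue. (norm (f t))\<^sup>2 * W t) + b / (2 * M) * (M * (S / b))"
      using assms(1,2) le_WT by (intro add_left_mono mult_left_mono) auto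
    \<comment> \<open>Half of \<open>S\<close> is absorbed on the left; doubling then turns
      \<open>M / (2 * b)\<close> into the stated constant.\<close>
    also have "b / (2 * M) * (M * (S / b)) = S / 2" using assms by simp
    finally show ?thesis using assms(1) by (simp add: S_def c_def field_simps)
  qed
qed

section \<open>Sums of tails at a point, and covering of the line by the supports\<close>

text \<open>\<open>j\<close> is an interval containing \<open>t\<close>, so its term vanishes, and
  \<open>1 / (2 * \<beta>)\<close> is a common radius. \<open>E\<close> will be
  \<open>E\<^sub>1\<close>.\<close>

lemma separated_tail_sum_le:
  fixes a b :: "int \<Rightarrow> real"
  assumes "0 < \<delta>" "1 < p" "0 < \<beta>" "finite K" "separated \<delta> a"
    and b: "\<And>k. \<beta> \<le> b k" and j: "\<bar>t - a j\<bar> \<le> 1 / (2 * b j)"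
    and sep: "\<delta> \<le> 1 / \<beta>" and E: "1 / (\<delta> * (p - 1)) + 1 / 2 \<le> E"
  shows "(\<Sum>k\<in>K. tail_weight (1 / (2 * b k)) p (t - a k)) \<le> 2 * E / (\<beta> * \<delta>)"
proof -
  define r where "r = 1 / (\<beta> * \<delta>)"
  have r: "1 \<le> r" using assms(1,3) sep by (simp add: r_def field_simps)
  have "0 < 1 / (\<delta> * (p - 1))" using assms(1,2) by simp
  then have "1 / 2 \<le> E" using E by linarith
  have "(\<Sum>k\<in>K. tail_weight (1 / (2 * b k)) p (t - a k)) \<le> (2 * (1 / (2 * \<beta>)) + 2 / (p - 1)) / \<delta>"
  proof (rule separated_sum_tail_weight_le[where j = j])
    show "1 / (2 * b k) \<le> 1 / (2 * \<beta>)" for k using b[of k] assms(3) by (simp add: frac_le)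
    show "\<delta> \<le> \<bar>(t - a k) - (t - a m)\<bar>" if "k \<noteq> m" for k m
    proof -
      have "\<delta> < \<bar>a k - a m\<bar>" using assms(5) that by (auto simp: separated_def)
      then show ?thesis by linarith
    qed
  qed (use assms(1,2,4) j in auto)
  also have "\<dots> = r + 2 * (1 / (\<delta> * (p - 1)))" using assms(1-3) by (simp add: r_def field_simps)
  \<comment> \<open>By the assumption on \<open>E\<close> it suffices that
    \<open>r + (2 * E - 1) \<le> 2 * E * r\<close>, that is
    \<open>0 \<le> (r - 1) * (2 * E - 1)\<close>. Here \<open>\<delta> \<le> 1 / \<beta>\<close>
    enters as \<open>1 \<le> r\<close>.\<close>
  also have "\<dots> \<le> 2 * E * r" using E mult_nonneg_nonneg[of "r - 1" "2 * E - 1"] r \<open>1 / 2 \<le> E\<close>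
    by (simp add: algebra_simps)
  also have "\<dots> = 2 * E / (\<beta> * \<delta>)" by (simp add: r_def)
  finally show ?thesis .
qed

text \<open>The step \<open>1 / b\<close> equals the width of the core, so some translate of
  \<open>t\<close> always falls into the core around \<open>a\<close> and has weight zero.\<close>

lemma lattice_tail_sum_le:
  fixes b :: real
  assumes "1 < p" "0 < b" "finite J"
  shows "(\<Sum>j\<in>J. tail_weight (1 / (2 * b)) p (t + of_int j * (1 / b) - a)) \<le> 1 + 2 * b / (p - 1)"
proof -
  \<comment> \<open>The lattice translate of \<open>t\<close> nearest to \<open>a\<close>; rounding
    leaves a distance of at most \<open>1 / (2 * b)\<close>.\<close>
  define m where "m = round (b * (a - t))"
  have "(\<Sum>j\<in>J. tail_weight (1 / (2 * b)) p (t + of_int j * (1 / b) - a)) \<le> (2 * (1 / (2 * b)) + 2 / (p - 1)) / (1 / b)"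
  proof (rule separated_sum_tail_weight_le[where j = m])
    show "1 / b \<le> \<bar>(t + of_int k * (1 / b) - a) - (t + of_int l * (1 / b) - a)\<bar>" if "k \<noteq> l" for k l :: int
    proof -
      have "1 \<le> \<bar>k - l\<bar>" using that by linarith
      then have "1 \<le> \<bar>of_int k - of_int l :: real\<bar>" by linarith
      then have "1 / b \<le> \<bar>of_int k - of_int l\<bar> / b" using assms(2) by (intro divide_right_mono) auto
      also have "\<dots> = \<bar>(of_int k - of_int l) / b\<bar>" using assms(2) by (simp add: abs_divide)
      finally show ?thesis by (simp add: diff_divide_distrib)
    qed
    have "\<bar>of_int m - b * (a - t)\<bar> \<le> 1 / 2" unfolding m_def by (rule of_int_round_abs_le)
    then have "\<bar>of_int m - b * (a - t)\<bar> / b \<le> 1 / 2 / b" using assms(2) by (intro divide_right_mono) auto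
    moreover have "\<bar>of_int m - b * (a - t)\<bar> / b = \<bar>(of_int m - b * (a - t)) / b\<bar>" using assms(2) by (simp add: abs_divide)
    moreover have "(of_int m - b * (a - t)) / b = t + of_int m * (1 / b) - a" using assms(2) by (simp add: field_simps)
    ultimately show "\<bar>t + of_int m * (1 / b) - a\<bar> \<le> 1 / (2 * b)" by simp
  qed (use assms in auto)
  also have "\<dots> = 1 + 2 * b / (p - 1)" using assms by (simp add: field_simps)
  finally show ?thesis .
qed

text \<open>If \<open>\<delta>\<close> exceeded \<open>2 * R\<close>, the points to the right of
  \<open>a 0\<close> at distance between \<open>R\<close> and \<open>\<delta> - R\<close> would form
  an uncovered set of positive measure: they are too far from \<open>a 0\<close>, and all other
  centres are farther than \<open>\<delta>\<close> from \<open>a 0\<close>.\<close>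

lemma separation_le_of_AE_cover:
  fixes a r :: "int \<Rightarrow> real"
  assumes "separated \<delta> a" and r: "\<And>k. r k \<le> R"
    and cover: "AE t in lebesgue. \<exists>k. \<bar>t - a k\<bar> \<le> r k"
  shows "\<delta> \<le> 2 * R"
proof (rule ccontr)
  assume less: "\<not> \<delta> \<le> 2 * R"
  have "AE t in lebesgue. t \<notin> {a 0 + R<..<a 0 + \<delta> - R}"
    using cover
  proof eventually_elim
    case (elim t)
    then obtain k where k: "\<bar>t - a k\<bar> \<le> R" using r order_trans by blast
    show ?case
    proof (cases "k = 0")
      case False
      then have "\<delta> < \<bar>a k - a 0\<bar>" using assms(1) by (auto simp: separated_def)
      with k show ?thesis by (auto simp: abs_if split: if_splits)
    qed (use k in auto)
  qed
  then have "{a 0 + R<..<a 0 + \<delta> - R} \<in> null_sets lebesgue"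
    by (subst AE_iff_null_sets) auto
  then show False using less by (auto simp: null_sets_def)
qed

text \<open>The indicator of an uncovered set is orthogonal to every atom, so the lower frame bound
  forces its norm to vanish.\<close>

lemma frame_supports_cover:
  assumes frame: "nsg_frame_bounds h b A B"
    and I [measurable]: "\<And>k. I k \<in> sets lebesgue"
    and supp: "\<And>k t. t \<notin> I k \<Longrightarrow> h k t = 0"
  shows "AE t in lebesgue. \<exists>k. t \<in> I k"
proof -
  define N where "N n = (UNIV - (\<Union>k. I k)) \<inter> {- real n..real n}" for n
  \<comment> \<open>Truncation to a bounded window makes the indicator square-integrable; the union
    over \<open>n\<close> recovers the whole uncovered set.\<close>
  have N [measurable]: "N n \<in> sets lebesgue" for n unfolding N_def by (intro sets.Int sets.Diff sets.countable_UN) auto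
  have null: "N n \<in> null_sets lebesgue" for n
  proof -
    define f :: "real \<Rightarrow> complex" where "f = indicator (N n)"
    have fin: "emeasure lebesgue (N n) < \<infinity>"
      using emeasure_mono[of "N n" "{- real n..real n}" lebesgue]
      by (auto simp: N_def intro: le_less_trans)
    have nf: "(\<lambda>t. (norm (f t))\<^sup>2) = indicator (N n)"
      by (auto simp: f_def indicator_def)
    have f: "f \<in> L2"
      unfolding L2_def using fin N by (auto simp: nf) (simp add: f_def)
    have "L2_inner f (gabor_atom h b k l) = 0" for k l
    proof -
      have *: "f t * cnj (gabor_atom h b k l t) = 0" for t
        using supp[of t k] by (auto simp: f_def N_def gabor_atom_def modulation_def indicator_def)
      show ?thesis unfolding L2_inner_def * by simp
    qed
    then have "(\<Sum>\<^sub>\<infinity>(k, l). (norm (L2_inner f (gabor_atom h b k l)))\<^sup>2) = 0"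
      by (intro infsum_0) auto
    moreover have "A * (L2_norm f)\<^sup>2 \<le> (\<Sum>\<^sub>\<infinity>(k, l). (norm (L2_inner f (gabor_atom h b k l)))\<^sup>2)"
      using frame f unfolding nsg_frame_bounds_def by blast
    moreover have "0 < A" using frame by (simp add: nsg_frame_bounds_def)
    ultimately have "A * (L2_norm f)\<^sup>2 \<le> 0" "0 < A" by simp_all
    then have "measure lebesgue (N n) \<le> 0"
      unfolding L2_norm_sq nf by (simp add: mult_le_0_iff)
    then show ?thesis
      using fin by (intro null_setsI) (auto simp: emeasure_eq_ennreal_measure measure_le_0_iff)
  qed
  have "{t \<in> space lebesgue. \<not> (\<exists>k. t \<in> I k)} \<subseteq> (\<Union>n. N n)"
  proof
    fix t assume "t \<in> {t \<in> space lebesgue. \<not> (\<exists>k. t \<in> I k)}"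
    moreover obtain n :: nat where "\<bar>t\<bar> \<le> n" using real_arch_simple by blast
    ultimately show "t \<in> (\<Union>n. N n)" by (auto simp: N_def intro!: exI[of _ n])
  qed
  then show ?thesis by (rule AE_I'[OF null_sets_UN[OF null]])
qed

section \<open>Perturbation of the frame inequalities\<close>

text \<open>The triangle inequality for finite sections, followed by passage to the full sums.
  \<open>u\<close> and \<open>v\<close> will be the coefficients of \<open>f\<close> against the
  atoms of \<open>h\<close> and \<open>\<psi>\<close>, and \<open>N\<close> the norm of
  \<open>f\<close>.\<close>

lemma frame_sum_perturbation:
  fixes u v :: "'i \<Rightarrow> complex"
  assumes "0 \<le> D" "D \<le> A" "0 \<le> B" "0 \<le> N"
    and sum_u: "(\<lambda>i. (norm (u i))\<^sup>2) summable_on UNIV"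
    and lower: "A * N\<^sup>2 \<le> (\<Sum>\<^sub>\<infinity>i. (norm (u i))\<^sup>2)"
    and upper: "(\<Sum>\<^sub>\<infinity>i. (norm (u i))\<^sup>2) \<le> B * N\<^sup>2"
    and v: "\<And>F. finite F \<Longrightarrow> (\<Sum>i\<in>F. (norm (v i))\<^sup>2) \<le> D * N\<^sup>2"
  shows "(\<lambda>i. (norm (u i + v i))\<^sup>2) summable_on UNIV"
    and "(sqrt A - sqrt D)\<^sup>2 * N\<^sup>2 \<le> (\<Sum>\<^sub>\<infinity>i. (norm (u i + v i))\<^sup>2)"
    and "(\<Sum>\<^sub>\<infinity>i. (norm (u i + v i))\<^sup>2) \<le> (sqrt B + sqrt D)\<^sup>2 * N\<^sup>2"
proof -
  define n2 where "n2 z F = L2_set (\<lambda>i. norm (z i)) F" for z :: "'i \<Rightarrow> complex" and F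
  have n2_sq: "(n2 z F)\<^sup>2 = (\<Sum>i\<in>F. (norm (z i))\<^sup>2)" for z F
    by (simp add: n2_def L2_set_def sum_nonneg)
  have n2_0: "0 \<le> n2 z F" for z F by (simp add: n2_def)
  have tri: "n2 (\<lambda>i. x i + y i) F \<le> n2 x F + n2 y F" for x y F
    unfolding n2_def by (rule order_trans[OF L2_set_mono L2_set_triangle_ineq]) (auto intro: norm_triangle_ineq)
  have n2_v: "n2 v F \<le> sqrt D * N" if "finite F" for F
    by (rule power2_le_imp_le) (use v[OF that] assms(1,4) in \<open>simp_all add: n2_sq power_mult_distrib\<close>)
  have n2_u: "n2 u F \<le> sqrt B * N" if "finite F" for F
  proof (rule power2_le_imp_le)
    have "(n2 u F)\<^sup>2 \<le> (\<Sum>\<^sub>\<infinity>i. (norm (u i))\<^sup>2)"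
      unfolding n2_sq using sum_u that by (intro finite_sum_le_infsum) auto
    then show "(n2 u F)\<^sup>2 \<le> (sqrt B * N)\<^sup>2" using upper assms(3) by (simp add: power_mult_distrib)
  qed (use assms(3,4) in auto)
  have fin: "(\<Sum>i\<in>F. (norm (u i + v i))\<^sup>2) \<le> (sqrt B + sqrt D)\<^sup>2 * N\<^sup>2" if "finite F" for F
  proof -
    have "n2 (\<lambda>i. u i + v i) F \<le> (sqrt B + sqrt D) * N"
      using tri[of u v F] n2_u[OF that] n2_v[OF that] by (simp add: distrib_right)
    from power_mono[OF this n2_0, of 2] show ?thesis by (simp add: n2_sq power_mult_distrib)
  qed
  show s: "(\<lambda>i. (norm (u i + v i))\<^sup>2) summable_on UNIV"
    using fin by (intro nonneg_bdd_above_summable_on bdd_aboveI2) auto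
  show "(\<Sum>\<^sub>\<infinity>i. (norm (u i + v i))\<^sup>2) \<le> (sqrt B + sqrt D)\<^sup>2 * N\<^sup>2"
    using s fin by (intro infsum_le_finite_sums) auto
  define X where "X = (\<Sum>\<^sub>\<infinity>i. (norm (u i + v i))\<^sup>2)"
  have X0: "0 \<le> X" by (simp add: X_def infsum_nonneg)
  \<comment> \<open>The lower bound comes from writing \<open>u\<close> as \<open>u + v\<close>
    minus \<open>v\<close>.\<close>
  have "(\<Sum>\<^sub>\<infinity>i. (norm (u i))\<^sup>2) \<le> (sqrt X + sqrt D * N)\<^sup>2"
  proof (rule infsum_le_finite_sums[OF sum_u])
    fix F :: "'i set" assume F: "finite F"
    have "(n2 (\<lambda>i. u i + v i) F)\<^sup>2 \<le> X"
      unfolding n2_sq X_def using s F by (intro finite_sum_le_infsum) auto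
    then have "n2 (\<lambda>i. u i + v i) F \<le> sqrt X" by (rule real_le_rsqrt)
    moreover have "n2 u F \<le> n2 (\<lambda>i. u i + v i) F + n2 (\<lambda>i. - v i) F"
      using tri[of "\<lambda>i. u i + v i" "\<lambda>i. - v i" F] by simp
    moreover have "n2 (\<lambda>i. - v i) F = n2 v F" by (simp add: n2_def)
    ultimately have "n2 u F \<le> sqrt X + sqrt D * N" using n2_v[OF F] by simp
    from power_mono[OF this n2_0, of 2] show "(\<Sum>i\<in>F. (norm (u i))\<^sup>2) \<le> (sqrt X + sqrt D * N)\<^sup>2"
      by (simp add: n2_sq)
  qed
  with lower have "(sqrt A * N)\<^sup>2 \<le> (sqrt X + sqrt D * N)\<^sup>2"
    using assms(1,2) by (simp add: power_mult_distrib)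
  then have "sqrt A * N \<le> sqrt X + sqrt D * N"
    using X0 assms(1,4) by (intro power2_le_imp_le[of "sqrt A * N"]) auto
  then have "(sqrt A - sqrt D) * N \<le> sqrt X" by (simp add: algebra_simps)
  \<comment> \<open>Squaring is legitimate because \<open>D \<le> A\<close> makes the left-hand side
    nonnegative.\<close>
  from power_mono[OF this, of 2] assms(1,2,4) show "(sqrt A - sqrt D)\<^sup>2 * N\<^sup>2 \<le> (\<Sum>\<^sub>\<infinity>i. (norm (u i + v i))\<^sup>2)"
    using X0 by (simp add: power_mult_distrib flip: X_def)
qed

section \<open>The Bessel bound of the tail system\<close>

text \<open>The constant is the product of \<open>2 * C * E' / \<beta>\<close>, from the Bessel
  bound of each window, and \<open>2 * C * E / (\<beta> * \<delta>)\<close>, the bound on the sum of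
  all majorants at almost every point.\<close>

lemma gabor_tail_bessel:
  fixes a b :: "int \<Rightarrow> real"
  assumes "0 < \<delta>" "1 < p" "0 < \<beta>" "0 < C" and sep: "separated \<delta> a"
    and b: "\<And>k. \<beta> \<le> b k"
    and meas: "\<And>k. \<psi> k \<in> borel_measurable lebesgue"
    and bound: "\<And>k. AE t in lebesgue. norm (\<psi> k t) \<le> C * tail_weight (1 / (2 * b k)) p (t - a k)"
    and cover: "AE t in lebesgue. \<exists>k. \<bar>t - a k\<bar> \<le> 1 / (2 * b k)"
    and E: "1 / (\<delta> * (p - 1)) + 1 / 2 \<le> E"
    and E': "\<And>k. b k / (p - 1) + 1 / 2 \<le> E'"
  shows "\<psi> k \<in> L2"
    and "f \<in> L2 \<Longrightarrow> finite F \<Longrightarrow>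
      (\<Sum>(k, l)\<in>F. (norm (L2_inner f (gabor_atom \<psi> b k l)))\<^sup>2)
        \<le> C\<^sup>2 * (4 * E * E' / (\<beta>\<^sup>2 * \<delta>)) * (L2_norm f)\<^sup>2"
proof -
  define W where "W k t = C * tail_weight (1 / (2 * b k)) p (t - a k)" for k t
  \<comment> \<open>Twice the assumption on \<open>E'\<close> dominates the lattice sum bound
    \<open>1 + 2 * b k / (p - 1)\<close>.\<close>
  define M where "M = 2 * C * E'"
  have b_pos: "0 < b k" for k using b[of k] assms(3) by linarith
  have W [measurable]: "W k \<in> borel_measurable borel" for k unfolding W_def by measurable
  have W0: "0 \<le> W k t" for k t using assms(4) by (simp add: W_def tail_weight_nonneg)
  have "0 < b 0 / (p - 1)" using b_pos[of 0] assms(2) by simp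
  then have "0 < E'" using E'[of 0] by linarith
  then have M: "0 < M" using assms(4) by (simp add: M_def)
  have sum_W: "(\<Sum>j\<in>J. W k (t + of_int j * (1 / b k))) \<le> M" if "finite J" for k t J
  proof -
    have "(\<Sum>j\<in>J. W k (t + of_int j * (1 / b k)))
        = C * (\<Sum>j\<in>J. tail_weight (1 / (2 * b k)) p (t + of_int j * (1 / b k) - a k))"
      by (simp add: W_def sum_distrib_left)
    also have "\<dots> \<le> C * (1 + 2 * b k / (p - 1))"
      using lattice_tail_sum_le[OF assms(2) b_pos that] assms(4) by (intro mult_left_mono) auto
    also have "\<dots> \<le> C * (2 * E')"
      using E'[of k] assms(4) by (intro mult_left_mono) auto
    finally show ?thesis by (simp add: M_def)
  qed
  note bessel = L2_of_summable_translates integrable_weighted_L2 weighted_bessel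
  note bessel = bessel[OF b_pos M meas W W0 sum_W bound[folded W_def]]
  show "\<psi> k \<in> L2" by (rule bessel(1))
  have sep_le: "\<delta> \<le> 1 / \<beta>"
    using separation_le_of_AE_cover[OF sep _ cover, of "1 / (2 * \<beta>)"] b assms(3) by (simp add: frac_le)
  show "(\<Sum>(k, l)\<in>F. (norm (L2_inner f (gabor_atom \<psi> b k l)))\<^sup>2)
        \<le> C\<^sup>2 * (4 * E * E' / (\<beta>\<^sup>2 * \<delta>)) * (L2_norm f)\<^sup>2" if f: "f \<in> L2" and F: "finite F" for f F
  proof -
    \<comment> \<open>Enlarging \<open>F\<close> to a rectangle gives each \<open>k\<close> the same
      finite set of \<open>l\<close>, so the single-window bound applies to every row.\<close>
    define K where "K = fst ` F"
    define L where "L = snd ` F"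
    have KL: "finite K" "finite L" "F \<subseteq> K \<times> L"
      using F by (auto simp: K_def L_def image_iff) force+
    have "(\<Sum>(k, l)\<in>F. (norm (L2_inner f (gabor_atom \<psi> b k l)))\<^sup>2)
        \<le> (\<Sum>(k, l)\<in>K \<times> L. (norm (L2_inner f (gabor_atom \<psi> b k l)))\<^sup>2)"
      using KL by (intro sum_mono2) auto
    also have "\<dots> = (\<Sum>k\<in>K. \<Sum>l\<in>L. (norm (L2_inner f (modulation (b k * of_int l) (\<psi> k))))\<^sup>2)"
      by (simp add: sum.cartesian_product gabor_atom_def)
    also have "\<dots> \<le> (\<Sum>k\<in>K. M / \<beta> * (LINT t|lebesgue. (norm (f t))\<^sup>2 * W k t))"
    proof (intro sum_mono)
      fix k
      have "(\<Sum>l\<in>L. (norm (L2_inner f (modulation (b k * of_int l) (\<psi> k))))\<^sup>2)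
          \<le> M / b k * (LINT t|lebesgue. (norm (f t))\<^sup>2 * W k t)"
        by (rule bessel(3)[OF _ f KL(2)])
      also have "\<dots> \<le> M / \<beta> * (LINT t|lebesgue. (norm (f t))\<^sup>2 * W k t)"
        using b[of k] assms(3) M W0
        by (intro mult_right_mono divide_left_mono Bochner_Integration.integral_nonneg) auto
      finally show "(\<Sum>l\<in>L. (norm (L2_inner f (modulation (b k * of_int l) (\<psi> k))))\<^sup>2)
          \<le> M / \<beta> * (LINT t|lebesgue. (norm (f t))\<^sup>2 * W k t)" .
    qed
    also have "\<dots> = M / \<beta> * (LINT t|lebesgue. (\<Sum>k\<in>K. (norm (f t))\<^sup>2 * W k t))"
      using bessel(2)[OF _ f]
      by (subst Bochner_Integration.integral_sum) (auto simp: sum_distrib_left)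
    also have "\<dots> \<le> M / \<beta> * (LINT t|lebesgue. (norm (f t))\<^sup>2 * (2 * C * E / (\<beta> * \<delta>)))"
    proof (intro mult_left_mono integral_mono_AE)
      show "integrable lebesgue (\<lambda>t. \<Sum>k\<in>K. (norm (f t))\<^sup>2 * W k t)"
        by (intro Bochner_Integration.integrable_sum bessel(2)[OF _ f])
      show "integrable lebesgue (\<lambda>t. (norm (f t))\<^sup>2 * (2 * C * E / (\<beta> * \<delta>)))"
        using f by (simp add: L2_def)
      show "AE t in lebesgue. (\<Sum>k\<in>K. (norm (f t))\<^sup>2 * W k t) \<le> (norm (f t))\<^sup>2 * (2 * C * E / (\<beta> * \<delta>))"
        using cover
      proof eventually_elim
        case (elim t)
        then obtain j where j: "\<bar>t - a j\<bar> \<le> 1 / (2 * b j)" by blast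
        have "(\<Sum>k\<in>K. W k t) = C * (\<Sum>k\<in>K. tail_weight (1 / (2 * b k)) p (t - a k))"
          by (simp add: W_def sum_distrib_left)
        also have "\<dots> \<le> C * (2 * E / (\<beta> * \<delta>))"
          using separated_tail_sum_le[where b = b and t = t, OF assms(1-3) KL(1) sep b j sep_le E] assms(4)
          by (intro mult_left_mono) auto
        finally have "(norm (f t))\<^sup>2 * (\<Sum>k\<in>K. W k t) \<le> (norm (f t))\<^sup>2 * (C * (2 * E / (\<beta> * \<delta>)))"
          by (intro mult_left_mono) auto
        then show ?case unfolding sum_distrib_left by (simp add: mult_ac)
      qed
      show "0 \<le> M / \<beta>" using M assms(3) by simp
    qed
    also have "\<dots> = C\<^sup>2 * (4 * E * E' / (\<beta>\<^sup>2 * \<delta>)) * (L2_norm f)\<^sup>2"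
      by (simp add: M_def power2_eq_square[of C] power2_eq_square[of \<beta>] mult_ac flip: L2_norm_sq)
    finally show ?thesis .
  qed
qed

section \<open>The constants of the criterion and the frame bounds of the perturbed system\<close>

theorem corollary3p8:
  fixes b\<^sub>L b\<^sub>U p\<^sub>L p\<^sub>U C\<^sub>L C\<^sub>U \<delta> A\<^sub>h E\<^sub>1 E\<^sub>2 lam :: real
    and a b p C :: "int \<Rightarrow> real"
    and g h \<psi> :: "int \<Rightarrow> real \<Rightarrow> complex"
    and I :: "int \<Rightarrow> real set"
  assumes "0 < b\<^sub>L" "b\<^sub>L \<le> b\<^sub>U" and "1 < p\<^sub>L" "p\<^sub>L \<le> p\<^sub>U" and "0 < C\<^sub>L" "C\<^sub>L \<le> C\<^sub>U"
    and "\<And>k. b k \<in> {b\<^sub>L..b\<^sub>U}"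
    and "\<And>k. p k \<in> {p\<^sub>L..p\<^sub>U}"
    and "\<And>k. C k \<in> {C\<^sub>L..C\<^sub>U}"
    and "0 < \<delta>" and "separated \<delta> a"
    and I_eq: "\<And>k. I k = {a k - inverse (2 * b k)..a k + inverse (2 * b k)}"
    and "\<And>k. g k \<in> wiener_space"
    and h_eq: "\<And>k t. h k t = g k t * indicator (I k) t"
    and psi_eq: "\<And>k t. \<psi> k t = g k t - h k t"
    and "\<exists>B. nsg_frame_bounds h b A\<^sub>h B"
    and "\<And>k. AE t in lebesgue.
           norm (\<psi> k t) \<le>
             (if t > a k + inverse (2 * b k)
                then C k * (1 + t - a k - inverse (2 * b k)) powr (- p k)
              else if t \<in> I k then 0
              else C k * (1 - t + a k - inverse (2 * b k)) powr (- p k))"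
    and E1_eq: "E\<^sub>1 = 1 + (inverse \<delta> + p\<^sub>L) / ((1 + \<delta>) powr p\<^sub>L * (p\<^sub>L - 1))"
    and E2_eq: "E\<^sub>2 = 1 + (b\<^sub>U + p\<^sub>U) / ((1 + inverse b\<^sub>U) powr p\<^sub>L * (p\<^sub>L - 1))"
    and lam_eq: "lam = 4 * inverse (b\<^sub>L\<^sup>2) * inverse \<delta> * E\<^sub>1 * E\<^sub>2"
    and "C\<^sub>U < sqrt (A\<^sub>h * inverse lam)"
  shows "nsg_frame g b"
proof -
  obtain B where frame: "nsg_frame_bounds h b A\<^sub>h B" using assms(16) by blast
  note bounds = \<open>\<And>k. b k \<in> {b\<^sub>L..b\<^sub>U}\<close> \<open>\<And>k. p k \<in> {p\<^sub>L..p\<^sub>U}\<close> \<open>\<And>k. C k \<in> {C\<^sub>L..C\<^sub>U}\<close>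
  have b: "b\<^sub>L \<le> b k" "b k \<le> b\<^sub>U" "0 < b k" for k
    using bounds(1)[of k] assms(1) by auto
  have C_pos: "0 < C\<^sub>U" using assms(5,6) by linarith
  have A: "0 < A\<^sub>h" "A\<^sub>h \<le> B" and h_L2: "\<And>k. h k \<in> L2"
    using frame by (auto simp: nsg_frame_bounds_def)
  have I_abs: "t \<in> I k \<longleftrightarrow> \<bar>t - a k\<bar> \<le> 1 / (2 * b k)" for t k
    unfolding I_eq inverse_eq_divide by (auto simp: abs_le_iff)
  have meas: "\<psi> k \<in> borel_measurable lebesgue" for k
  proof -
    have "g k \<in> borel_measurable lebesgue"
      using \<open>\<And>k. g k \<in> wiener_space\<close>[of k] by (simp add: wiener_space_def Linf_def)
    moreover have "h k \<in> borel_measurable lebesgue" using h_L2[of k] by (simp add: L2_def)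
    ultimately show ?thesis unfolding psi_eq[abs_def] by (rule borel_measurable_diff)
  qed
  have bound: "AE t in lebesgue. norm (\<psi> k t) \<le> C\<^sub>U * tail_weight (1 / (2 * b k)) p\<^sub>L (t - a k)" for k
    using assms(17)[of k]
  proof eventually_elim
    case (elim t)
    show ?case
    proof (cases "t \<in> I k")
      case True
      then have "\<psi> k t = 0" by (simp add: psi_eq h_eq)
      then show ?thesis using C_pos by (simp add: tail_weight_nonneg)
    next
      case False
      define \<rho> where "\<rho> = 1 / (2 * b k)"
      have \<rho>: "0 < \<rho>" "inverse (2 * b k) = \<rho>" using b(3)[of k] by (simp_all add: \<rho>_def inverse_eq_divide)
      \<comment> \<open>Both nonzero branches of the assumed bound equal
        \<open>C k * y powr (- p k)\<close>. Since \<open>1 \<le> y\<close>, the exponent may be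
        lowered to \<open>p\<^sub>L\<close>.\<close>
      define y where "y = 1 + \<bar>t - a k\<bar> - \<rho>"
      have y: "1 \<le> y" using False by (simp add: I_abs y_def \<rho>_def)
      have "norm (\<psi> k t) \<le> C k * y powr (- p k)"
        using elim False \<rho>(1) unfolding y_def I_eq \<rho>(2)
        by (auto simp: abs_if algebra_simps split: if_splits)
      also have "\<dots> \<le> C\<^sub>U * y powr (- p\<^sub>L)"
        using bounds(2,3)[of k] C_pos y by (intro mult_mono powr_mono) auto
      also have "\<dots> = C\<^sub>U * tail_weight (1 / (2 * b k)) p\<^sub>L (t - a k)"
        using False by (simp add: tail_weight_def y_def I_abs \<rho>_def)
      finally show ?thesis .
    qed
  qed
  have cover: "AE t in lebesgue. \<exists>k. \<bar>t - a k\<bar> \<le> 1 / (2 * b k)"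
    unfolding I_abs[symmetric] by (rule frame_supports_cover[OF frame]) (auto simp: I_eq h_eq)
  have E1: "1 / (\<delta> * (p\<^sub>L - 1)) + 1 / 2 \<le> E\<^sub>1"
    using trapezoid_le_integral_test[OF \<open>0 < \<delta>\<close> assms(3)] by (simp add: E1_eq inverse_eq_divide)
  have E2: "b k / (p\<^sub>L - 1) + 1 / 2 \<le> E\<^sub>2" for k
  proof -
    \<comment> \<open>The case \<open>d = 1 / b k\<close>. Passing to \<open>b\<^sub>U\<close> and
      \<open>p\<^sub>U\<close> afterwards raises the numerator and lowers the denominator.\<close>
    have "b k / (p\<^sub>L - 1) + 1 / 2 \<le> 1 + (b k + p\<^sub>L) / ((1 + 1 / b k) powr p\<^sub>L * (p\<^sub>L - 1))"
      using trapezoid_le_integral_test[of "1 / b k", OF _ assms(3)] b(3)[of k] by simp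
    also have "\<dots> \<le> 1 + (b\<^sub>U + p\<^sub>U) / ((1 + 1 / b\<^sub>U) powr p\<^sub>L * (p\<^sub>L - 1))"
    proof (intro add_left_mono frac_le)
      have "1 / b\<^sub>U \<le> 1 / b k" using b[of k] by (simp add: frac_le)
      then have "(1 + 1 / b\<^sub>U) powr p\<^sub>L \<le> (1 + 1 / b k) powr p\<^sub>L"
        using assms(1-3) by (intro powr_mono2) auto
      then show "(1 + 1 / b\<^sub>U) powr p\<^sub>L * (p\<^sub>L - 1) \<le> (1 + 1 / b k) powr p\<^sub>L * (p\<^sub>L - 1)"
        using assms(3) by (intro mult_right_mono) auto
      have "0 < 1 + 1 / b\<^sub>U" using assms(1,2) by (intro add_pos_nonneg) auto
      then show "0 < (1 + 1 / b\<^sub>U) powr p\<^sub>L * (p\<^sub>L - 1)" using assms(3) by simp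
    qed (use b[of k] assms(1-4) in auto)
    finally show ?thesis by (simp add: E2_eq inverse_eq_divide)
  qed
  \<comment> \<open>The Bessel bound of the tail system; the assumption on \<open>C\<^sub>U\<close>
    says exactly that it lies below \<open>A\<^sub>h\<close>.\<close>
  define D where "D = C\<^sub>U\<^sup>2 * lam"
  have E_pos: "0 < E\<^sub>1" "0 < E\<^sub>2"
  proof -
    have "0 < 1 / (\<delta> * (p\<^sub>L - 1))" "0 < b 0 / (p\<^sub>L - 1)" using assms(3) \<open>0 < \<delta>\<close> b(3) by auto
    then show "0 < E\<^sub>1" "0 < E\<^sub>2" using E1 E2[of 0] by linarith+
  qed
  have lam: "lam = 4 * E\<^sub>1 * E\<^sub>2 / (b\<^sub>L\<^sup>2 * \<delta>)" by (simp add: lam_eq divide_inverse mult_ac)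
  have lam_pos: "0 < lam" using E_pos assms(1) \<open>0 < \<delta>\<close> by (simp add: lam)
  have "C\<^sub>U\<^sup>2 < (sqrt (A\<^sub>h * inverse lam))\<^sup>2"
    using assms(21) C_pos by (intro power_strict_mono) auto
  also have "\<dots> = A\<^sub>h * inverse lam" using A lam_pos by simp
  finally have "C\<^sub>U\<^sup>2 < A\<^sub>h * inverse lam" .
  then have D: "0 \<le> D" "D < A\<^sub>h" using lam_pos by (auto simp: D_def field_simps)
  note bessel = gabor_tail_bessel[OF \<open>0 < \<delta>\<close> assms(3,1) C_pos \<open>separated \<delta> a\<close> b(1) meas bound cover E1 E2]
  have psi_L2: "\<psi> k \<in> L2" for k by (rule bessel(1))
  have g_eq: "g k t = h k t + \<psi> k t" for k t by (simp add: psi_eq)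
  \<comment> \<open>Square-integrability is part of being a frame: \<open>h k\<close> has it from
    its frame property, \<open>\<psi> k\<close> from its decay.\<close>
  have g_L2: "g k \<in> L2" for k unfolding g_eq[abs_def] by (rule L2_add[OF h_L2 psi_L2])
  have inner: "L2_inner f (gabor_atom g b k l) = L2_inner f (gabor_atom h b k l) + L2_inner f (gabor_atom \<psi> b k l)"
    if "f \<in> L2" for f k l
    using L2_integrable_mult_cnj[OF that L2_modulation[OF h_L2[of k]]]
      L2_integrable_mult_cnj[OF that L2_modulation[OF psi_L2[of k]]]
    by (simp add: L2_inner_def gabor_atom_def g_eq modulation_eq_cis distrib_left flip: Bochner_Integration.integral_add)
  have "nsg_frame_bounds g b ((sqrt A\<^sub>h - sqrt D)\<^sup>2) ((sqrt B + sqrt D)\<^sup>2)"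
    unfolding nsg_frame_bounds_def
  proof (intro conjI allI ballI g_L2 b(3))
    show "0 < (sqrt A\<^sub>h - sqrt D)\<^sup>2" using D by simp
    have "sqrt A\<^sub>h - sqrt D \<le> sqrt B + sqrt D" using real_sqrt_le_mono[OF A(2)] real_sqrt_ge_zero[OF D(1)] by linarith
    then show "(sqrt A\<^sub>h - sqrt D)\<^sup>2 \<le> (sqrt B + sqrt D)\<^sup>2" using D by (intro power_mono) auto
  next
    fix f assume f: "f \<in> L2"
    define u where "u = (\<lambda>(k, l). L2_inner f (gabor_atom h b k l))"
    define v where "v = (\<lambda>(k, l). L2_inner f (gabor_atom \<psi> b k l))"
    have u: "(\<lambda>i. (norm (u i))\<^sup>2) = (\<lambda>(k, l). (norm (L2_inner f (gabor_atom h b k l)))\<^sup>2)"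
      by (auto simp: u_def)
    have v: "(\<lambda>i. (norm (v i))\<^sup>2) = (\<lambda>(k, l). (norm (L2_inner f (gabor_atom \<psi> b k l)))\<^sup>2)"
      by (auto simp: v_def)
    have uv: "(\<lambda>i. (norm (u i + v i))\<^sup>2) = (\<lambda>(k, l). (norm (L2_inner f (gabor_atom g b k l)))\<^sup>2)"
      using inner[OF f] by (auto simp: u_def v_def)
    have "0 \<le> B" "0 \<le> L2_norm f" using A by (auto simp: L2_norm_def)
    note pert = frame_sum_perturbation[OF D(1) less_imp_le[OF D(2)] this, of u v, unfolded u v uv]
    have v_le: "(\<Sum>(k, l)\<in>F. (norm (L2_inner f (gabor_atom \<psi> b k l)))\<^sup>2) \<le> D * (L2_norm f)\<^sup>2" if "finite F" for F
      unfolding D_def lam by (rule bessel(2)[OF f that])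
    have fr: "(\<lambda>(k, l). (norm (L2_inner f (gabor_atom h b k l)))\<^sup>2) summable_on UNIV"
      "A\<^sub>h * (L2_norm f)\<^sup>2 \<le> (\<Sum>\<^sub>\<infinity>(k, l). (norm (L2_inner f (gabor_atom h b k l)))\<^sup>2)"
      "(\<Sum>\<^sub>\<infinity>(k, l). (norm (L2_inner f (gabor_atom h b k l)))\<^sup>2) \<le> B * (L2_norm f)\<^sup>2"
      using frame f unfolding nsg_frame_bounds_def by blast+
    show "(\<lambda>(k, l). (norm (L2_inner f (gabor_atom g b k l)))\<^sup>2) summable_on UNIV"
      "(sqrt A\<^sub>h - sqrt D)\<^sup>2 * (L2_norm f)\<^sup>2 \<le> (\<Sum>\<^sub>\<infinity>(k, l). (norm (L2_inner f (gabor_atom g b k l)))\<^sup>2)"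
      "(\<Sum>\<^sub>\<infinity>(k, l). (norm (L2_inner f (gabor_atom g b k l)))\<^sup>2) \<le> (sqrt B + sqrt D)\<^sup>2 * (L2_norm f)\<^sup>2"
      using pert[OF fr v_le] by simp_all
  qed
  then show ?thesis unfolding nsg_frame_def by blast
qed

end
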